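(* Let $G$ be the $d$-dimensional hypercube, with $n=2^d$ vertices, in which exactly one vertex $s$ is designated as the sink, and let $\sigma$ be a configuration with $N$ chips in total on the non-sink vertices. Then the following greedy simulation algorithm terminates after $O(n^2\log(nN))$ iterations: while some non-sink vertex is full, choose a non-sink vertex $u$ maximizing $\lfloor\sigma_u/\deg(u)\rfloor$, let $k=\lfloor\sigma_u/\deg(u)\rfloor$, set $\sigma_u\leftarrow\sigma_u-k\deg(u)$ and add $k$ chips to every non-sink neighbor of $u$ (one iteration = one execution of this loop body).
   Context: The $d$-dimensional hypercube has vertex set $\{0,1\}^d$, two vertices being adjacent iff they differ in exactly one coordinate. Sandpile with a sink: $\sigma\in\mathbb{N}^{V(G)}$ gives chip counts; the sink never fires and chips sent to it are discarded; a non-sink vertex $v$ is full if $\sigma_v\ge\deg(v)$ (degree counts all neighbors, including $s$); firing $v$ decreases $\sigma_v$ by $\deg(v)$ and adds one chip to each neighbor; a configuration is terminal if no non-sink vertex is full. *)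

theory Defs
  imports Complex_Main "HOL-Library.FuncSet"
begin

text \<open>
  A finite simple graph is given by its vertex set \<open>V\<close> and a symmetric irreflexive adjacency
  relation \<open>E\<close>. A configuration is a function \<open>'v \<Rightarrow> nat\<close>; only its values on \<open>V - {s}\<close> are ever
  inspected or modified, so the values at the sink \<open>s\<close> and outside \<open>V\<close> are irrelevant.
\<close>

definition degree :: "'v set \<Rightarrow> ('v \<Rightarrow> 'v \<Rightarrow> bool) \<Rightarrow> 'v \<Rightarrow> nat" where
  "degree V E v = card {w \<in> V. E v w}"

definition full :: "'v set \<Rightarrow> ('v \<Rightarrow> 'v \<Rightarrow> bool) \<Rightarrow> ('v \<Rightarrow> nat) \<Rightarrow> 'v \<Rightarrow> bool" where
  "full V E \<sigma> v \<longleftrightarrow> degree V E v \<le> \<sigma> v"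

definition terminal :: "'v set \<Rightarrow> ('v \<Rightarrow> 'v \<Rightarrow> bool) \<Rightarrow> 'v \<Rightarrow> ('v \<Rightarrow> nat) \<Rightarrow> bool" where
  "terminal V E s \<sigma> \<longleftrightarrow> \<not> (\<exists>v \<in> V - {s}. full V E \<sigma> v)"

definition total_chips :: "'v set \<Rightarrow> 'v \<Rightarrow> ('v \<Rightarrow> nat) \<Rightarrow> nat" where
  "total_chips V s \<sigma> = (\<Sum>v \<in> V - {s}. \<sigma> v)"

text \<open>Firing the non-sink vertex \<open>u\<close> \<open>k\<close> times at once; chips sent to \<open>s\<close> are discarded.\<close>

definition fire_times ::
  "'v set \<Rightarrow> ('v \<Rightarrow> 'v \<Rightarrow> bool) \<Rightarrow> 'v \<Rightarrow> 'v \<Rightarrow> nat \<Rightarrow> ('v \<Rightarrow> nat) \<Rightarrow> 'v \<Rightarrow> nat" where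
  "fire_times V E s u k \<sigma> = (\<lambda>v.
     if v = u then \<sigma> v - k * degree V E u
     else if v \<in> V - {s} \<and> E u v then \<sigma> v + k
     else \<sigma> v)"

text \<open>
  One execution of the loop body, guarded by the loop condition. It is a relation because ties
  between maximizing vertices may be broken arbitrarily.
\<close>

definition greedy_step ::
  "'v set \<Rightarrow> ('v \<Rightarrow> 'v \<Rightarrow> bool) \<Rightarrow> 'v \<Rightarrow> ('v \<Rightarrow> nat) \<Rightarrow> ('v \<Rightarrow> nat) \<Rightarrow> bool" where
  "greedy_step V E s \<sigma> \<tau> \<longleftrightarrow>
     \<not> terminal V E s \<sigma> \<and>
     (\<exists>u. is_arg_max (\<lambda>v. \<sigma> v div degree V E v) (\<lambda>v. v \<in> V - {s}) u \<and>
          \<tau> = fire_times V E s u (\<sigma> u div degree V E u) \<sigma>)"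

definition cube_verts :: "nat \<Rightarrow> (nat \<Rightarrow> nat) set" where
  "cube_verts d = {..<d} \<rightarrow>\<^sub>E {0, 1}"

definition cube_adj :: "nat \<Rightarrow> (nat \<Rightarrow> nat) \<Rightarrow> (nat \<Rightarrow> nat) \<Rightarrow> bool" where
  "cube_adj d x y \<longleftrightarrow>
     x \<in> cube_verts d \<and> y \<in> cube_verts d \<and> card {i \<in> {..<d}. x i \<noteq> y i} = 1"

end

theory Submission
  imports Defs
begin

text \<open>
  Let \<open>h\<close> be nonnegative with \<open>h s = 0\<close> and \<open>deg v * h v - (\<Sum>w\<sim>v. h w) = 1\<close> off the sink
  (the expected hitting time of \<open>s\<close> divided by the degree). Firing \<open>u\<close> exactly \<open>k\<close> times lowers
  the potential \<open>\<Sum>v. h v * \<sigma> v\<close> by \<open>k\<close>. By the greedy choice no vertex holds more than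
  \<open>deg * (k + 1)\<close> chips, so the potential is at most \<open>2 * k * n * deg * max h\<close>, and each iteration
  shrinks it by a constant factor. On the hypercube \<open>h\<close> depends only on the distance to \<open>s\<close>,
  has an explicit form through tails of binomial sums, and is at most \<open>3 * n / d\<close>; the factor is thus
  \<open>1 - 1 / (6 * n^2)\<close>. The potential is at least 1 before any iteration, which bounds their number.
\<close>

section \<open>Linear potentials on a graph with a sink\<close>

definition potential :: "'v set \<Rightarrow> 'v \<Rightarrow> ('v \<Rightarrow> real) \<Rightarrow> ('v \<Rightarrow> nat) \<Rightarrow> real" where
  "potential V s h \<sigma> = (\<Sum>v \<in> V - {s}. h v * real (\<sigma> v))"

lemma potential_nonneg:
  assumes "\<And>v. v \<in> V \<Longrightarrow> 0 \<le> h v"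
  shows "0 \<le> potential V s h \<sigma>"
  unfolding potential_def using assms by (intro sum_nonneg) auto

lemma potential_le_total_chips:
  assumes "\<And>v. v \<in> V \<Longrightarrow> h v \<le> M"
  shows "potential V s h \<sigma> \<le> M * real (total_chips V s \<sigma>)"
  unfolding potential_def total_chips_def of_nat_sum sum_distrib_left
  using assms by (intro sum_mono mult_right_mono) auto

text \<open>The potential is linear in the chips: \<open>u\<close> loses \<open>k * deg\<close>
  copies of \<open>h u\<close> and each neighbour \<open>w\<close> gains \<open>k\<close> copies of
  \<open>h w\<close>. Discarding the chips sent to \<open>s\<close> costs nothing, because
  \<open>h s = 0\<close>.\<close>

lemma potential_fire_times:
  assumes "finite V" "u \<in> V - {s}" "\<not> E u u" "h s = 0"
    and "k * degree V E u \<le> \<sigma> u"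
    and harm: "real (degree V E u) * h u - (\<Sum>w \<in> {w \<in> V. E u w}. h w) = 1"
  shows "potential V s h (fire_times V E s u k \<sigma>) = potential V s h \<sigma> - real k"
proof -
  have eq: "h v * real (fire_times V E s u k \<sigma> v)
      = h v * real (\<sigma> v) - (if v = u then real k * (real (degree V E u) * h u) else 0)
        + real k * (if E u v then h v else 0)" if "v \<in> V - {s}" for v
    using that assms by (auto simp: fire_times_def algebra_simps of_nat_diff)
  have nb: "(\<Sum>v \<in> V - {s}. if E u v then h v else 0) = (\<Sum>w \<in> {w \<in> V. E u w}. h w)"
  proof -
    have "(\<Sum>v \<in> V - {s}. if E u v then h v else 0) = (\<Sum>v \<in> V. if E u v then h v else 0)"
      using assms by (intro sum.mono_neutral_left) auto
    also have "\<dots> = (\<Sum>w \<in> {w \<in> V. E u w}. h w)"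
      using assms by (simp add: sum.inter_filter)
    finally show ?thesis .
  qed
  have "potential V s h (fire_times V E s u k \<sigma>)
      = potential V s h \<sigma> - real k * (real (degree V E u) * h u)
        + real k * (\<Sum>w \<in> {w \<in> V. E u w}. h w)"
    unfolding potential_def nb[symmetric] sum_distrib_left
    using assms by (simp add: eq sum.distrib sum_subtractf sum_distrib_left)
  also have "\<dots> = potential V s h \<sigma>
      - real k * (real (degree V E u) * h u - (\<Sum>w \<in> {w \<in> V. E u w}. h w))"
    by (simp add: algebra_simps)
  finally show ?thesis by (simp add: harm)
qed

lemma greedy_step_potential:
  assumes fin: "finite V" and irrefl: "\<And>v. \<not> E v v" and "h s = 0"
    and deg: "\<And>v. v \<in> V \<Longrightarrow> degree V E v = D" and D: "D > 0"
    and h0: "\<And>v. v \<in> V \<Longrightarrow> 0 \<le> h v" and hM: "\<And>v. v \<in> V \<Longrightarrow> h v \<le> M"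
    and harm: "\<And>v. v \<in> V - {s} \<Longrightarrow>
          real (degree V E v) * h v - (\<Sum>w \<in> {w \<in> V. E v w}. h w) = 1"
    and step: "greedy_step V E s \<sigma> \<tau>"
  shows "1 \<le> potential V s h \<sigma>"
    and "potential V s h \<tau> \<le> (1 - 1 / (2 * M * D * card V)) * potential V s h \<sigma>"
proof -
  let ?P = "potential V s h"
  obtain u where mx: "is_arg_max (\<lambda>v. \<sigma> v div degree V E v) (\<lambda>v. v \<in> V - {s}) u"
    and \<tau>: "\<tau> = fire_times V E s u (\<sigma> u div degree V E u) \<sigma>"
    using step by (auto simp: greedy_step_def)
  obtain v where v: "v \<in> V - {s}" "D \<le> \<sigma> v"
    using step deg by (auto simp: greedy_step_def terminal_def full_def)
  define k where "k = \<sigma> u div D"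
  have u: "u \<in> V - {s}" using mx by (auto simp: is_arg_max_def)
  have max_k: "\<sigma> w div D \<le> k" if "w \<in> V - {s}" for w
    using mx that u deg by (force simp: is_arg_max_linorder k_def)
  have "1 \<le> \<sigma> v div D" using v D by (simp add: Suc_le_eq div_greater_zero_iff)
  then have k1: "1 \<le> k" using max_k[OF v(1)] by linarith
  have "k * degree V E u \<le> \<sigma> u" using u deg by (auto simp: k_def)
  then have drop: "?P \<tau> = ?P \<sigma> - real k"
    using potential_fire_times[of V u s E h k \<sigma>] assms u deg by (auto simp: \<tau> k_def)
  \<comment> \<open>The potential is still nonnegative after losing \<open>k\<close>, and
    \<open>k\<close> is at least 1, so it was at least 1 before.\<close>
  have "0 \<le> ?P \<tau>" by (intro potential_nonneg h0)
  then show "1 \<le> ?P \<sigma>" using drop k1 by linarith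
  have chips: "\<sigma> w \<le> 2 * k * D" if "w \<in> V - {s}" for w
  proof -
    have "\<sigma> w < D * (k + 1)"
      using max_k[OF that] D by (metis div_less_iff_less_mult less_add_one mult.commute order_le_less_trans)
    also have "\<dots> \<le> 2 * k * D" using k1 D by (simp add: algebra_simps)
    finally show ?thesis by simp
  qed
  have "0 \<le> M" using h0[of u] hM[of u] u by auto
  have "total_chips V s \<sigma> \<le> card (V - {s}) * (2 * k * D)"
    unfolding total_chips_def using sum_bounded_above[of "V - {s}" \<sigma>, OF chips] by simp
  also have "\<dots> \<le> card V * (2 * k * D)"
    using fin by (intro mult_right_mono card_mono) auto
  finally have "real (total_chips V s \<sigma>) \<le> real (card V * (2 * k * D))"
    by (rule of_nat_mono)
  then have "M * real (total_chips V s \<sigma>) \<le> M * real (card V * (2 * k * D))"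
    using \<open>0 \<le> M\<close> by (rule mult_left_mono)
  then have up: "?P \<sigma> \<le> real k * (2 * M * D * card V)"
    using potential_le_total_chips[of V h M s \<sigma>] hM by (simp add: algebra_simps)
  \<comment> \<open>Dividing by the factor needs its positivity, which the lower bound 1 on the
    potential provides.\<close>
  then have "0 < real k * (2 * M * D * card V)"
    using \<open>1 \<le> ?P \<sigma>\<close> by linarith
  then have "0 < 2 * M * D * card V" using k1 by (simp add: zero_less_mult_iff)
  then have "?P \<sigma> / (2 * M * D * card V) \<le> real k" using up by (simp add: pos_divide_le_eq)
  then show "?P \<tau> \<le> (1 - 1 / (2 * M * D * card V)) * ?P \<sigma>"
    using drop by (simp add: algebra_simps)
qed

section \<open>Iterating steps: decay and progress\<close>

lemma relpowp_geometric_decay: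
  fixes \<Phi> :: "'a \<Rightarrow> real"
  assumes "(R ^^ m) x y" and "0 \<le> q" and "\<And>x y. R x y \<Longrightarrow> \<Phi> y \<le> q * \<Phi> x"
  shows "\<Phi> y \<le> q ^ m * \<Phi> x"
  using assms(1)
proof (induction m arbitrary: y)
  case (Suc m)
  then obtain z where "(R ^^ m) x z" "R z y" by auto
  then have "\<Phi> y \<le> q * \<Phi> z" "\<Phi> z \<le> q ^ m * \<Phi> x" using assms(3) Suc.IH by auto
  then show ?case using mult_left_mono[OF _ assms(2)] by (fastforce simp: mult.assoc)
qed simp

text \<open>A finite nonempty set of non-sink vertices has a maximizer, so the loop never gets
  stuck. This turns a bound on the length of runs into termination.\<close>

lemma greedy_step_exists:
  assumes "finite V" "\<not> terminal V E s \<sigma>"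
  shows "\<exists>\<tau>. greedy_step V E s \<sigma> \<tau>"
proof -
  let ?f = "\<lambda>v. \<sigma> v div degree V E v"
  have "V - {s} \<noteq> {}" using assms by (auto simp: terminal_def)
  then have "Max (?f ` (V - {s})) \<in> ?f ` (V - {s})" using assms by (intro Max_in) auto
  then obtain u where u: "u \<in> V - {s}" "Max (?f ` (V - {s})) = ?f u"
    by (elim imageE)
  have "?f v \<le> ?f u" if "v \<in> V - {s}" for v
    using Max_ge[of "?f ` (V - {s})" "?f v"] that assms unfolding u(2) by simp
  then have "is_arg_max ?f (\<lambda>v. v \<in> V - {s}) u" using u(1) by (auto simp: is_arg_max_linorder)
  then show ?thesis using assms by (auto simp: greedy_step_def)
qed

section \<open>Binomial estimates and the radial profile of \<open>h\<close> on the cube\<close>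

text \<open>Pascal's rule: by induction one summand is at least \<open>m - 1\<close>, and the other
  is positive.\<close>

lemma le_binomial:
  assumes "0 < i" "i < m"
  shows "m \<le> m choose i"
  using assms
proof (induction m arbitrary: i)
  case (Suc m)
  then obtain j where j: "i = Suc j" by (cases i) auto
  show ?case
  proof (cases "i = m")
    case False
    then have "m \<le> m choose i" using Suc j by auto
    moreover have "1 \<le> m choose j" using Suc.prems j by (simp add: Suc_le_eq)
    ultimately show ?thesis by (simp add: j)
  qed (simp add: j)
qed simp

text \<open>For positive \<open>m\<close> the two ends contribute 1 each, and the
  \<open>m - 1\<close> inner terms are at most \<open>1 / m\<close> each.\<close>

lemma sum_inverse_binomial_le: "(\<Sum>i\<le>m. 1 / real (m choose i)) \<le> 3"
proof (cases m)
  case (Suc l)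
  have "(\<Sum>i\<in>{0<..<m}. 1 / real (m choose i)) \<le> (\<Sum>i\<in>{0<..<m}. 1 / real m)"
    using le_binomial by (intro sum_mono divide_left_mono) auto
  also have "\<dots> \<le> 1" using Suc by simp
  finally have "(\<Sum>i\<in>{0<..<m}. 1 / real (m choose i)) \<le> 1" .
  moreover have "{..m} = insert 0 (insert m {0<..<m})" using Suc by auto
  ultimately show ?thesis using Suc by simp
qed simp

text \<open>
  \<open>hit d r\<close> is the value of \<open>h\<close> at distance \<open>r\<close> from the sink; summing the equation for \<open>h\<close> over all
  vertices at distance at least \<open>r\<close> gives the increment \<open>h(r) - h(r - 1)\<close> below.
\<close>

definition hit_inc :: "nat \<Rightarrow> nat \<Rightarrow> real" where
  "hit_inc d r = (\<Sum>j=r..d. real (d choose j)) / (real r * real (d choose r))"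

definition hit :: "nat \<Rightarrow> nat \<Rightarrow> real" where
  "hit d r = (\<Sum>i=1..r. hit_inc d i)"

lemma hit_0 [simp]: "hit d 0 = 0"
  by (simp add: hit_def)

lemma hit_Suc: "hit d (Suc r) = hit d r + hit_inc d (Suc r)"
  by (simp add: hit_def)

lemma hit_inc_nonneg: "0 \<le> hit_inc d r"
  by (simp add: hit_inc_def sum_nonneg)

text \<open>This is the equation for \<open>h\<close> at distance \<open>r\<close>, written in
  increments. Absorption gives both terms the denominator \<open>d choose r\<close>; their
  numerators are consecutive tails, which differ by exactly that binomial.\<close>

lemma hit_inc_recurrence:
  assumes "1 \<le> r" "r \<le> d"
  shows "real r * hit_inc d r - real (d - r) * hit_inc d (Suc r) = 1"
proof -
  have pos: "0 < real (d choose r)" using assms by simp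
  have split: "(\<Sum>j=r..d. real (d choose j))
      = real (d choose r) + (\<Sum>j=Suc r..d. real (d choose j))"
    using assms by (simp add: sum.atLeast_Suc_atMost)
  have a: "real r * hit_inc d r = (\<Sum>j=r..d. real (d choose j)) / real (d choose r)"
    using assms by (simp add: hit_inc_def)
  have b: "real (d - r) * hit_inc d (Suc r)
      = (\<Sum>j=Suc r..d. real (d choose j)) / real (d choose r)"
  \<comment> \<open>At \<open>r = d\<close> both sides vanish: the factor \<open>d - r\<close> is 0
    and the tail is empty.\<close>
  proof (cases "r = d")
    case False
    have "Suc r * (d choose Suc r) = (d - r) * (d choose r)"
      by (metis binomial_absorb_comp binomial_absorption)
    then have "real (Suc r) * real (d choose Suc r) = real (d - r) * real (d choose r)"
      by (metis of_nat_mult)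
    then show ?thesis using False assms by (simp add: hit_inc_def)
  qed simp
  show ?thesis unfolding a b split using pos by (simp add: field_simps)
qed

text \<open>Each tail is at most \<open>2 ^ d\<close>, and absorption turns the denominators into
  \<open>d\<close> times the binomials of row \<open>d - 1\<close>, whose reciprocals sum to at most
  3.\<close>

lemma hit_le:
  assumes "1 \<le> d" "r \<le> d"
  shows "hit d r \<le> 3 * 2 ^ d / real d"
proof -
  have inc: "hit_inc d (Suc i) \<le> 2 ^ d / real d * (1 / real ((d - 1) choose i))" if "i < d" for i
  proof -
    have "Suc i * (d choose Suc i) = d * ((d - 1) choose i)"
      by (rule binomial_absorption)
    then have eq: "real (Suc i) * real (d choose Suc i) = real d * real ((d - 1) choose i)"
      by (metis of_nat_mult)
    have "(\<Sum>j=Suc i..d. d choose j) \<le> (\<Sum>j\<le>d. d choose j)"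
      by (intro sum_mono2) auto
    then have "(\<Sum>j=Suc i..d. d choose j) \<le> 2 ^ d" by (simp add: choose_row_sum)
    then have "(\<Sum>j=Suc i..d. real (d choose j)) \<le> 2 ^ d"
      by (metis of_nat_sum of_nat_le_iff of_nat_numeral of_nat_power)
    then show ?thesis unfolding hit_inc_def eq by (simp add: divide_right_mono)
  qed
  have "hit d r \<le> hit d d"
    unfolding hit_def using assms by (intro sum_mono2) (auto simp: hit_inc_nonneg)
  also have "\<dots> = (\<Sum>i<d. hit_inc d (Suc i))"
    unfolding hit_def by (simp add: sum.atLeast1_atMost_eq)
  also have "\<dots> \<le> (\<Sum>i<d. 2 ^ d / real d * (1 / real ((d - 1) choose i)))"
    using inc by (intro sum_mono) auto
  also have "\<dots> = 2 ^ d / real d * (\<Sum>i\<le>d - 1. 1 / real ((d - 1) choose i))"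
    unfolding sum_distrib_left using assms
    by (intro sum.cong) auto
  also have "\<dots> \<le> 2 ^ d / real d * 3"
    by (intro mult_left_mono sum_inverse_binomial_le) auto
  also have "\<dots> = 3 * 2 ^ d / real d" by simp
  finally show ?thesis .
qed

section \<open>Geometry of the hypercube\<close>

lemma finite_cube_verts: "finite (cube_verts d)"
  by (simp add: cube_verts_def finite_PiE)

lemma card_cube_verts: "card (cube_verts d) = 2 ^ d"
  by (simp add: cube_verts_def card_PiE numeral_2_eq_2)

text \<open>The Hamming distance, which is also the graph distance in the cube.\<close>

definition cube_dist :: "nat \<Rightarrow> (nat \<Rightarrow> nat) \<Rightarrow> (nat \<Rightarrow> nat) \<Rightarrow> nat" where
  "cube_dist d x y = card {i \<in> {..<d}. x i \<noteq> y i}"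

lemma cube_dist_self [simp]: "cube_dist d x x = 0"
  by (simp add: cube_dist_def)

lemma cube_dist_le: "cube_dist d x y \<le> d"
  unfolding cube_dist_def by (rule order_trans[OF card_mono[of "{..<d}"]]) auto

lemma cube_verts_01: "v \<in> cube_verts d \<Longrightarrow> i < d \<Longrightarrow> v i = 0 \<or> v i = 1"
  by (auto simp: cube_verts_def)

lemma cube_dist_pos:
  assumes "x \<in> cube_verts d" "y \<in> cube_verts d" "x \<noteq> y"
  shows "1 \<le> cube_dist d x y"
proof -
  have "\<exists>i<d. x i \<noteq> y i"
    using assms PiE_ext[of x "{..<d}" "\<lambda>_. {0, 1}" y] unfolding cube_verts_def by blast
  then show ?thesis by (auto simp: cube_dist_def Suc_le_eq card_gt_0_iff)
qed

text \<open>Parametrizing neighbours by the flipped coordinate turns sums over neighbours into sums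
  over \<open>{..<d}\<close>.\<close>

lemma cube_neighbours:
  assumes v: "v \<in> cube_verts d"
  shows "{w \<in> cube_verts d. cube_adj d v w} = (\<lambda>i. v(i := 1 - v i)) ` {..<d}"
proof (intro equalityI subsetI)
  fix w assume w: "w \<in> {w \<in> cube_verts d. cube_adj d v w}"
  then obtain i where i: "{i \<in> {..<d}. v i \<noteq> w i} = {i}"
    by (auto simp: cube_adj_def card_1_singleton_iff)
  then have i_d: "i < d" by blast
  have iff: "v j \<noteq> w j \<longleftrightarrow> j = i" if "j < d" for j
    using i that by blast
  have w_V: "w \<in> cube_verts d" using w by simp
  have "w j = (v(i := 1 - v i)) j" for j
  proof (cases "j < d")
    case True
    then show ?thesis using iff[OF True] cube_verts_01[OF v True] cube_verts_01[OF w_V True] by auto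
  next
    case False
    \<comment> \<open>Beyond dimension \<open>d\<close> both functions are \<open>undefined\<close>,
      as vertices are extensional.\<close>
    then show ?thesis using i_d w_V v by (auto simp: cube_verts_def PiE_def extensional_def)
  qed
  then have "w = v(i := 1 - v i)" by (rule ext)
  then show "w \<in> (\<lambda>i. v(i := 1 - v i)) ` {..<d}" using i_d by blast
next
  fix w assume "w \<in> (\<lambda>i. v(i := 1 - v i)) ` {..<d}"
  then obtain i where i: "i < d" "w = v(i := 1 - v i)" by auto
  then have ne: "v i \<noteq> w i" using cube_verts_01[OF v i(1)] by auto
  have "w \<in> cube_verts d"
    using v i by (auto simp: cube_verts_def PiE_def Pi_def extensional_def)
  moreover have "{j \<in> {..<d}. v j \<noteq> w j} = {i}" using ne i by auto
  ultimately show "w \<in> {w \<in> cube_verts d. cube_adj d v w}" using v by (simp add: cube_adj_def)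
qed

lemma inj_on_flip:
  assumes "v \<in> cube_verts d"
  shows "inj_on (\<lambda>i. v(i := 1 - v i)) {..<d}"
proof (rule inj_onI)
  fix i j assume ij: "i \<in> {..<d}" "j \<in> {..<d}" "v(i := 1 - v i) = v(j := 1 - v j)"
  show "i = j"
    using fun_cong[OF ij(3), of i] cube_verts_01[OF assms, of i] ij by (auto split: if_splits)
qed

lemma degree_cube:
  assumes "v \<in> cube_verts d"
  shows "degree (cube_verts d) (cube_adj d) v = d"
  unfolding degree_def cube_neighbours[OF assms] card_image[OF inj_on_flip[OF assms]] by simp

lemma cube_dist_flip:
  assumes "v \<in> cube_verts d" "s \<in> cube_verts d" "i < d"
  shows "cube_dist d (v(i := 1 - v i)) s
    = (if v i \<noteq> s i then cube_dist d v s - 1 else Suc (cube_dist d v s))"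
proof -
  let ?A = "{j \<in> {..<d}. v j \<noteq> s j}"
  have "{j \<in> {..<d}. (v(i := 1 - v i)) j \<noteq> s j} = (if v i \<noteq> s i then ?A - {i} else insert i ?A)"
    using assms cube_verts_01[OF assms(1,3)] cube_verts_01[OF assms(2,3)] by auto
  then show ?thesis using assms by (auto simp: cube_dist_def)
qed

text \<open>Of the \<open>d\<close> neighbours of a vertex at distance \<open>r\<close>, exactly
  \<open>r\<close> are one step closer to \<open>s\<close> and \<open>d - r\<close> one step
  farther. The claim thus reduces to the recurrence for the increments.\<close>

lemma hit_laplacian:
  assumes v: "v \<in> cube_verts d" "v \<noteq> s" and s: "s \<in> cube_verts d"
  shows "real d * hit d (cube_dist d v s)
    - (\<Sum>w \<in> {w \<in> cube_verts d. cube_adj d v w}. hit d (cube_dist d w s)) = 1"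
proof -
  define r where "r = cube_dist d v s"
  let ?A = "{i \<in> {..<d}. v i \<noteq> s i}"
  have r: "1 \<le> r" "r \<le> d" using cube_dist_pos v s cube_dist_le by (auto simp: r_def)
  have card_A: "card ?A = r" by (simp add: r_def cube_dist_def)
  then have card_compl: "card ({..<d} - ?A) = d - r"
    using card_Diff_subset[of ?A "{..<d}"] by auto
  have flip: "cube_dist d (v(i := 1 - v i)) s = (if v i \<noteq> s i then r - 1 else Suc r)"
    if "i < d" for i
    using cube_dist_flip[OF v(1) s that] by (simp only: r_def)
  have "(\<Sum>w \<in> {w \<in> cube_verts d. cube_adj d v w}. hit d (cube_dist d w s))
      = (\<Sum>i<d. hit d (cube_dist d (v(i := 1 - v i)) s))"
    unfolding cube_neighbours[OF v(1)] sum.reindex[OF inj_on_flip[OF v(1)]] by simp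
  also have "\<dots> = (\<Sum>i\<in>{..<d} - ?A. hit d (cube_dist d (v(i := 1 - v i)) s))
      + (\<Sum>i\<in>?A. hit d (cube_dist d (v(i := 1 - v i)) s))"
    by (rule sum.subset_diff) auto
  also have "(\<Sum>i\<in>{..<d} - ?A. hit d (cube_dist d (v(i := 1 - v i)) s))
      = (\<Sum>i\<in>{..<d} - ?A. hit d (Suc r))"
    by (rule sum.cong[OF refl], subst flip) auto
  also have "(\<Sum>i\<in>?A. hit d (cube_dist d (v(i := 1 - v i)) s)) = (\<Sum>i\<in>?A. hit d (r - 1))"
    by (rule sum.cong[OF refl], subst flip) auto
  also have "(\<Sum>i\<in>{..<d} - ?A. hit d (Suc r)) + (\<Sum>i\<in>?A. hit d (r - 1))
      = real (d - r) * hit d (Suc r) + real r * hit d (r - 1)"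
    by (simp only: sum_constant card_A card_compl)
  finally have sum: "(\<Sum>w \<in> {w \<in> cube_verts d. cube_adj d v w}. hit d (cube_dist d w s))
      = real (d - r) * hit d (Suc r) + real r * hit d (r - 1)" .
  have hit_r: "hit d r = hit d (r - 1) + hit_inc d r" using hit_Suc[of d "r - 1"] r by simp
  have d_r: "real d = real (d - r) + real r" using r by simp
  \<comment> \<open>Here \<open>a = d - r\<close> and \<open>b = r\<close> count the outward and
    inward neighbours; \<open>g\<close> and \<open>g'\<close> are the increments at \<open>r\<close>
    and \<open>r + 1\<close>.\<close>
  have "(a + b) * y - (a * (y + g') + b * x) = b * g - a * g'" if "y = x + g"
    for a b x y g g' :: real
    using that by (simp add: algebra_simps)
  from this[OF hit_r, of "real (d - r)" "real r" "hit_inc d (Suc r)"]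
  have "real d * hit d r - (real (d - r) * hit d (Suc r) + real r * hit d (r - 1))
      = real r * hit_inc d r - real (d - r) * hit_inc d (Suc r)"
    unfolding d_r[symmetric] hit_Suc .
  then show ?thesis unfolding sum r_def[symmetric] hit_inc_recurrence[OF r] .
qed

section \<open>Counting iterations on the hypercube\<close>

text \<open>The constant is \<open>19 = 6 * 3 + 1\<close>: 6 from the decay factor, 3 from absorbing
  a constant into the logarithm, and 1 for the last iteration.\<close>

lemma greedy_steps_cube_le:
  assumes s: "s \<in> cube_verts d"
    and steps: "(greedy_step (cube_verts d) (cube_adj d) s ^^ m) \<sigma> \<tau>"
    and N: "total_chips (cube_verts d) s \<sigma> = N" and n: "n = 2 ^ d"
  shows "real m \<le> 19 * (real n)\<^sup>2 * ln (real n * real N)"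
proof (cases m)
  case 0
  \<comment> \<open>For \<open>N = 0\<close> this relies on the default value
    \<open>ln 0 = 0\<close>; otherwise the argument is at least 1.\<close>
  have "0 \<le> ln (real n * real N)" using n by (cases "N = 0") (auto simp: mult_ge1_I)
  then show ?thesis using 0 by simp
next
  case (Suc l)
  let ?V = "cube_verts d" and ?E = "cube_adj d"
  let ?h = "\<lambda>v. hit d (cube_dist d v s)"
  let ?P = "potential ?V s ?h"
  define M where "M = 3 * 2 ^ d / real d"
  define q where "q = 1 - 1 / (6 * (real n)\<^sup>2)"
  \<comment> \<open>The lower bound 1 on the potential holds only where a step is possible, so decay
    is measured over the first \<open>l = m - 1\<close> steps.\<close>
  obtain \<rho> where \<rho>: "(greedy_step ?V ?E s ^^ l) \<sigma> \<rho>" and last: "greedy_step ?V ?E s \<rho> \<tau>"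
    using relpowp_Suc_E steps[unfolded Suc] by metis
  \<comment> \<open>In dimension 0 the sink is the only vertex, so no step exists.\<close>
  have d: "1 \<le> d"
  proof (rule ccontr)
    assume "\<not> 1 \<le> d"
    then have "d = 0" by simp
    then have "?V - {s} = {}" using s by (simp add: cube_verts_def)
    then show False using last unfolding greedy_step_def terminal_def by blast
  qed
  then have n2: "2 \<le> real n" unfolding n using power_increasing[of 1 d "2::real"] by simp
  have M: "?h v \<le> M" for v unfolding M_def by (intro hit_le d cube_dist_le)
  have h0: "0 \<le> ?h v" for v by (simp add: hit_def sum_nonneg hit_inc_nonneg)
  have q_eq: "1 - 1 / (2 * M * d * card ?V) = q"
    using d n by (simp add: M_def q_def card_cube_verts power2_eq_square)
  have irrefl: "\<not> ?E v v" for v by (simp add: cube_adj_def)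
  have harm: "real (degree ?V ?E v) * ?h v - (\<Sum>w \<in> {w \<in> ?V. ?E v w}. ?h w) = 1"
    if "v \<in> ?V - {s}" for v
    using that hit_laplacian[of v d s] s by (simp add: degree_cube)
  have step1: "1 \<le> ?P x" and stepq: "?P y \<le> q * ?P x" if "greedy_step ?V ?E s x y" for x y
    using greedy_step_potential[of ?V ?E ?h s d M x y, OF finite_cube_verts irrefl _
        degree_cube _ h0 M harm that, unfolded q_eq] d by simp_all
  have "1 \<le> (real n)\<^sup>2" using n2 by (simp add: one_le_power)
  then have "1 / (6 * (real n)\<^sup>2) \<le> 1" using divide_le_eq_1_pos[of "6 * (real n)\<^sup>2" 1] by linarith
  then have q0: "0 \<le> q" by (simp add: q_def)
  have "1 \<le> ?P \<rho>" by (rule step1[OF last])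
  also have "\<dots> \<le> q ^ l * ?P \<sigma>" by (rule relpowp_geometric_decay[OF \<rho> q0 stepq])
  also have "\<dots> \<le> q ^ l * (3 * real n * real N)"
  proof (intro mult_left_mono)
    \<comment> \<open>Dropping the factor \<open>1 / d\<close> is harmless, since this bound only
      enters the logarithm.\<close>
    have "M \<le> 3 * 2 ^ d / 1" unfolding M_def using d by (intro divide_left_mono) auto
    then have M_le: "M \<le> 3 * real n" using n by simp
    have "?P \<sigma> \<le> M * real N" using potential_le_total_chips[of ?V ?h M s \<sigma>] M N by simp
    also have "\<dots> \<le> 3 * real n * real N" using M_le by (intro mult_right_mono) auto
    finally show "?P \<sigma> \<le> 3 * real n * real N" .
  qed (simp add: q0)
  also have "\<dots> \<le> exp (- (1 / (6 * (real n)\<^sup>2))) ^ l * (3 * real n * real N)"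
    using exp_ge_add_one_self[of "- (1 / (6 * (real n)\<^sup>2))"] q0
    by (intro mult_right_mono power_mono) (auto simp: q_def)
  also have "\<dots> = exp (- (real l / (6 * (real n)\<^sup>2))) * (3 * real n * real N)"
    by (simp add: exp_of_nat_mult[symmetric])
  finally have key: "1 \<le> exp (- (real l / (6 * (real n)\<^sup>2))) * (3 * real n * real N)" .
  then have "N \<noteq> 0" by (intro notI) simp
  then have nN: "2 \<le> real n * real N" using mult_mono[of 2 "real n" 1 "real N"] n2 by simp
  have "exp (real l / (6 * (real n)\<^sup>2)) \<le> 3 * (real n * real N)"
    using key by (simp add: exp_minus field_simps)
  \<comment> \<open>\<open>3 * x\<close> is at most \<open>x ^ 3\<close> for \<open>x\<close> at
    least 2, so the constant disappears into the exponent.\<close>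
  also have "\<dots> \<le> (real n * real N) ^ 3"
  proof -
    have "3 \<le> (real n * real N)\<^sup>2" using power_mono[OF nN, of 2] by simp
    then have "3 * (real n * real N) \<le> (real n * real N)\<^sup>2 * (real n * real N)"
      using nN by (intro mult_right_mono) auto
    then show ?thesis by (simp add: power3_eq_cube power2_eq_square)
  qed
  finally have "ln (exp (real l / (6 * (real n)\<^sup>2))) \<le> ln ((real n * real N) ^ 3)"
    using nN by (subst ln_le_cancel_iff) auto
  then have "real l / (6 * (real n)\<^sup>2) \<le> 3 * ln (real n * real N)"
    using nN by (simp add: ln_realpow)
  then have l: "real l \<le> 18 * ((real n)\<^sup>2 * ln (real n * real N))"
    using n2 by (simp add: field_simps)
  \<comment> \<open>The product of \<open>n ^ 2\<close>, at least 4, and the logarithm, at least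
    \<open>1 / 2\<close>, exceeds 1 and so pays for the last iteration.\<close>
  have "1 / 2 \<le> ln (2::real)" using ln_le_minus_one[of "1 / 2 :: real"] by (simp add: ln_div)
  also have "\<dots> \<le> ln (real n * real N)" using nN by (subst ln_le_cancel_iff) auto
  finally have "4 * (1 / 2) \<le> (real n)\<^sup>2 * ln (real n * real N)"
    using power_mono[OF n2, of 2] by (intro mult_mono) auto
  then show ?thesis using l Suc by simp
qed

text \<open>Every run obeys the length bound, and a run that is not terminal can be continued;
  together these give termination for any tie-breaking.\<close>

theorem theorem4p10:
  "\<exists>C > (0::real). \<forall>(d::nat) (n::nat) (N::nat) (s :: nat \<Rightarrow> nat) (\<sigma> :: (nat \<Rightarrow> nat) \<Rightarrow> nat).
     n = 2 ^ d \<longrightarrow> s \<in> cube_verts d \<longrightarrow> total_chips (cube_verts d) s \<sigma> = N \<longrightarrow>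
     (\<forall>m \<tau>. (greedy_step (cube_verts d) (cube_adj d) s ^^ m) \<sigma> \<tau> \<longrightarrow>
        real m \<le> C * (real n)\<^sup>2 * ln (real n * real N) \<and>
        (terminal (cube_verts d) (cube_adj d) s \<tau> \<or>
         (\<exists>\<tau>'. greedy_step (cube_verts d) (cube_adj d) s \<tau> \<tau>')))"
proof (intro exI[of _ "19::real"] conjI allI impI)
  fix d n N m :: nat and s \<sigma> \<tau>
  assume "n = 2 ^ d" "s \<in> cube_verts d" "total_chips (cube_verts d) s \<sigma> = N"
    "(greedy_step (cube_verts d) (cube_adj d) s ^^ m) \<sigma> \<tau>"
  then show "real m \<le> 19 * (real n)\<^sup>2 * ln (real n * real N)"
    by (intro greedy_steps_cube_le)
  show "terminal (cube_verts d) (cube_adj d) s \<tau> \<or>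
      (\<exists>\<tau>'. greedy_step (cube_verts d) (cube_adj d) s \<tau> \<tau>')"
    using greedy_step_exists[OF finite_cube_verts] by blast
qed simp

end
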